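(* Let $t\ge1$ be an integer, $(P,d)$ a finite metric space with $P=B\cupdot R$, $|B|\ge t|R|$, and $k\ge1$. Let $\mathrm{OPT}_{\mathrm{fair}}$ be the radius (cost) of an optimal $1:t$-fair $k$-center with outliers solution (with $|B|-t|R|$ outliers). Then the algorithm \textsc{compute-$1:t$-fairlets} described in the context, with threshold factor $\tau=2$, computes a $1:t$-fairlet decomposition $\mathcal F$ with $d(r,b)\le 2\,\mathrm{OPT}_{\mathrm{fair}}$ for every $f\in\mathcal F$, the anchor $r\in f\cap R$ of $f$, and every blue point $b\in f\cap B$.
   Context: A $1:t$-fairlet is a set $f\subseteq P$ with $|f\cap R|=1$ and $|f\cap B|=t$. A $1:t$-fairlet decomposition of $P$ is a maximal set of pairwise disjoint $1:t$-fairlets (under $|B|\ge t|R|$ it covers all of $R$). The anchor of a fairlet is its unique red point. A $1:t$-fair $k$-clustering with $z$ outliers is a set $C\subseteq P$ of at most $k$ centers and a map $\alpha:P\to C\cup\{\perp\}$ with $|\alpha^{-1}(\perp)|\le z$ such that each cluster $Q=\alpha^{-1}(c)$ satisfies $|Q\cap B|=t|Q\cap R|$; its cost is $\max_{\alpha(x)\ne\perp}d(x,\alpha(x))$. Here $z=|B|-t|R|$. \textsc{compute-$1:t$-fairlets} with threshold factor $\tau$: let $D=\{d(x,y):x,y\in P\}$, sorted increasingly. For $\delta\in D$ in this order build the flow network $N_\delta$ with vertices $B\cup R\cup\{v,w\}$, source $v$, sink $w$, edges $(v,b)$ of capacity $1$ ($b\in B$), edges $(b,r)$ of capacity $1$ ($b\in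 B,r\in R$, $d(b,r)\le\tau\delta$), and edges $(r,w)$ of capacity $t$ ($r\in R$); compute a maximum integral flow $\mathbf f$. At the first $\delta$ with $|\mathbf f|=t|R|$ return $\mathcal F=\{f_r:r\in R\}$, $f_r=\{r\}\cup\{b\in B:\mathbf f(b,r)=1\}$, with anchors $\mathrm{anc}(f_r)=r$. *)

theory Defs
  imports "HOL-Analysis.Analysis"
begin

section \<open>Fairlets\<close>

text \<open>Throughout, the point set is \<open>P = B \<union> R\<close> with blue points \<open>B\<close> and red points \<open>R\<close>.\<close>

definition fairlet :: "'a set \<Rightarrow> 'a set \<Rightarrow> nat \<Rightarrow> 'a set \<Rightarrow> bool" where
  "fairlet B R t f \<longleftrightarrow> f \<subseteq> B \<union> R \<and> card (f \<inter> R) = 1 \<and> card (f \<inter> B) = t"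

definition disjoint_fairlets :: "'a set \<Rightarrow> 'a set \<Rightarrow> nat \<Rightarrow> 'a set set \<Rightarrow> bool" where
  "disjoint_fairlets B R t F \<longleftrightarrow> (\<forall>f\<in>F. fairlet B R t f) \<and> pairwise disjnt F"

text \<open>Maximality is with respect to inclusion.\<close>

definition fairlet_decomposition :: "'a set \<Rightarrow> 'a set \<Rightarrow> nat \<Rightarrow> 'a set set \<Rightarrow> bool" where
  "fairlet_decomposition B R t F \<longleftrightarrow>
     disjoint_fairlets B R t F \<and> (\<forall>G. disjoint_fairlets B R t G \<and> F \<subseteq> G \<longrightarrow> G = F)"

definition anchor :: "'a set \<Rightarrow> 'a set \<Rightarrow> 'a" where
  "anchor R f = (THE r. r \<in> f \<inter> R)"


section \<open>Fair clustering with outliers\<close>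

text \<open>The outlier symbol \<open>\<bottom>\<close> is \<open>None\<close>; values of \<open>\<alpha>\<close> outside \<open>B \<union> R\<close> are irrelevant.\<close>

definition fair_clustering ::
  "'a set \<Rightarrow> 'a set \<Rightarrow> nat \<Rightarrow> nat \<Rightarrow> nat \<Rightarrow> 'a set \<Rightarrow> ('a \<Rightarrow> 'a option) \<Rightarrow> bool" where
  "fair_clustering B R t k z C \<alpha> \<longleftrightarrow>
     C \<subseteq> B \<union> R \<and> card C \<le> k \<and>
     (\<forall>x\<in>B \<union> R. \<alpha> x \<in> insert None (Some ` C)) \<and>
     card {x \<in> B \<union> R. \<alpha> x = None} \<le> z \<and>
     (\<forall>c\<in>C. card ({x \<in> B \<union> R. \<alpha> x = Some c} \<inter> B)
             = t * card ({x \<in> B \<union> R. \<alpha> x = Some c} \<inter> R))"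

text \<open>Distances are nonnegative, so inserting 0 only fixes the cost to be 0 when every point
  is an outlier.\<close>

definition clustering_cost ::
  "('a \<Rightarrow> 'a \<Rightarrow> real) \<Rightarrow> 'a set \<Rightarrow> ('a \<Rightarrow> 'a option) \<Rightarrow> real" where
  "clustering_cost d P \<alpha> = Max (insert 0 {d x c |x c. x \<in> P \<and> \<alpha> x = Some c})"

definition OPT_fair ::
  "('a \<Rightarrow> 'a \<Rightarrow> real) \<Rightarrow> 'a set \<Rightarrow> 'a set \<Rightarrow> nat \<Rightarrow> nat \<Rightarrow> real" where
  "OPT_fair d B R t k =
     Inf {clustering_cost d (B \<union> R) \<alpha> |C \<alpha>. fair_clustering B R t k (card B - t * card R) C \<alpha>}"


lemma ex_fair_clustering:
  assumes fin: "finite B" "finite R" and "B \<inter> R = {}" and "B \<union> R \<noteq> {}"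
    and le: "t * card R \<le> card B" and "1 \<le> k"
  shows "\<exists>C \<alpha>. fair_clustering B R t k (card B - t * card R) C \<alpha>"
proof -
  obtain c where c: "c \<in> B \<union> R" using assms by blast
  obtain S where S: "S \<subseteq> B" "card S = t * card R" "finite S"
    using le by (rule obtain_subset_with_card_n)
  define \<alpha> where "\<alpha> = (\<lambda>x. if x \<in> S \<union> R then Some c else None)"
  have none: "{x \<in> B \<union> R. \<alpha> x = None} = B - S" using assms(3) S by (auto simp: \<alpha>_def)
  have some: "{x \<in> B \<union> R. \<alpha> x = Some c} = S \<union> R" using S by (auto simp: \<alpha>_def)
  have "(S \<union> R) \<inter> B = S" "(S \<union> R) \<inter> R = R" using assms(3) S by auto
  moreover have "card (B - S) = card B - t * card R" using S by (simp add: card_Diff_subset)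
  moreover have "\<forall>x\<in>B \<union> R. \<alpha> x \<in> insert None (Some ` {c})" by (simp add: \<alpha>_def)
  ultimately have "fair_clustering B R t k (card B - t * card R) {c} \<alpha>"
    using c \<open>1 \<le> k\<close> S(2) none some unfolding fair_clustering_def by simp
  then show ?thesis by blast
qed

text \<open>The infimum is attained, so it is the cost of an optimal solution.\<close>

lemma OPT_fair_attained:
  assumes fin: "finite B" "finite R" and "B \<inter> R = {}" and "B \<union> R \<noteq> {}"
    and "t * card R \<le> card B" and "1 \<le> k"
  shows "\<exists>C \<alpha>. fair_clustering B R t k (card B - t * card R) C \<alpha> \<and>
               clustering_cost d (B \<union> R) \<alpha> = OPT_fair d B R t k"
proof -
  let ?P = "B \<union> R"
  let ?V = "{clustering_cost d ?P \<alpha> |C \<alpha>. fair_clustering B R t k (card B - t * card R) C \<alpha>}"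
  let ?D = "insert 0 ((\<lambda>(x, y). d x y) ` (?P \<times> ?P))"
  have finD: "finite ?D" using fin by simp
  have "clustering_cost d ?P \<alpha> \<in> ?D" if "fair_clustering B R t k z C \<alpha>" for z C \<alpha>
  proof -
    let ?S = "insert 0 {d x c |x c. x \<in> ?P \<and> \<alpha> x = Some c}"
    have sub: "?S \<subseteq> ?D"
    proof
      fix v assume "v \<in> ?S"
      then consider "v = 0" | x c where "v = d x c" "x \<in> ?P" "\<alpha> x = Some c" by blast
      then show "v \<in> ?D"
      proof cases
        case 2
        have "\<alpha> x \<in> insert None (Some ` C)" "C \<subseteq> ?P"
          using that 2(2) unfolding fair_clustering_def by blast+
        with 2 have "c \<in> ?P" by auto
        with 2 show ?thesis by (auto simp: image_iff)
      qed simp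
    qed
    then have "Max ?S \<in> ?S" using finite_subset[OF sub finD] by (intro Max_in) auto
    then show ?thesis using sub unfolding clustering_cost_def by blast
  qed
  then have "?V \<subseteq> ?D" by blast
  then have "finite ?V" using finD by (rule finite_subset)
  moreover have "?V \<noteq> {}" using ex_fair_clustering[OF assms] by blast
  ultimately have "Inf ?V = Min ?V" "Min ?V \<in> ?V" by (rule cInf_eq_Min, rule Min_in)
  then have "Inf ?V \<in> ?V" by (rule ssubst)
  then obtain C \<alpha> where "fair_clustering B R t k (card B - t * card R) C \<alpha>"
    and "Inf ?V = clustering_cost d ?P \<alpha>" by blast
  then show ?thesis unfolding OPT_fair_def by (intro exI[of _ C] exI[of _ \<alpha>] conjI) (assumption, rule sym)
qed


section \<open>Integral flows\<close>

record 'v flow_network =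
  verts :: "'v set"
  edges :: "('v \<times> 'v) set"
  cap :: "'v \<times> 'v \<Rightarrow> int"
  source :: 'v
  sink :: 'v

definition outflow :: "'v flow_network \<Rightarrow> ('v \<times> 'v \<Rightarrow> int) \<Rightarrow> 'v \<Rightarrow> int" where
  "outflow N f u = (\<Sum>e\<in>{e \<in> edges N. fst e = u}. f e)"

definition inflow :: "'v flow_network \<Rightarrow> ('v \<times> 'v \<Rightarrow> int) \<Rightarrow> 'v \<Rightarrow> int" where
  "inflow N f u = (\<Sum>e\<in>{e \<in> edges N. snd e = u}. f e)"

definition integral_flow :: "'v flow_network \<Rightarrow> ('v \<times> 'v \<Rightarrow> int) \<Rightarrow> bool" where
  "integral_flow N f \<longleftrightarrow>
     (\<forall>e\<in>edges N. 0 \<le> f e \<and> f e \<le> cap N e) \<and>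
     (\<forall>e. e \<notin> edges N \<longrightarrow> f e = 0) \<and>
     (\<forall>u\<in>verts N - {source N, sink N}. inflow N f u = outflow N f u)"

definition flow_value :: "'v flow_network \<Rightarrow> ('v \<times> 'v \<Rightarrow> int) \<Rightarrow> int" where
  "flow_value N f = outflow N f (source N) - inflow N f (source N)"

definition max_integral_flow :: "'v flow_network \<Rightarrow> ('v \<times> 'v \<Rightarrow> int) \<Rightarrow> bool" where
  "max_integral_flow N f \<longleftrightarrow>
     integral_flow N f \<and> (\<forall>g. integral_flow N g \<longrightarrow> flow_value N g \<le> flow_value N f)"


section \<open>The fairlet algorithm\<close>

datatype 'a node = Source | Sink | Pt 'a

definition fairlet_network ::
  "('a \<Rightarrow> 'a \<Rightarrow> real) \<Rightarrow> 'a set \<Rightarrow> 'a set \<Rightarrow> nat \<Rightarrow> real \<Rightarrow> real \<Rightarrow> 'a node flow_network" where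
  "fairlet_network d B R t \<tau> \<delta> = \<lparr>
     verts = Pt ` (B \<union> R) \<union> {Source, Sink},
     edges = {(Source, Pt b) |b. b \<in> B}
           \<union> {(Pt b, Pt r) |b r. b \<in> B \<and> r \<in> R \<and> d b r \<le> \<tau> * \<delta>}
           \<union> {(Pt r, Sink) |r. r \<in> R},
     cap = (\<lambda>(x, y). if y = Sink then int t else 1),
     source = Source,
     sink = Sink \<rparr>"

definition distances :: "('a \<Rightarrow> 'a \<Rightarrow> real) \<Rightarrow> 'a set \<Rightarrow> real set" where
  "distances d P = {d x y |x y. x \<in> P \<and> y \<in> P}"

definition flow_fairlets :: "'a set \<Rightarrow> 'a set \<Rightarrow> ('a node \<times> 'a node \<Rightarrow> int) \<Rightarrow> 'a set set" where
  "flow_fairlets B R f = {{r} \<union> {b \<in> B. f (Pt b, Pt r) = 1} |r. r \<in> R}"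

text \<open>Maximum flows are not unique, so the algorithm is parametrised by the max-flow subroutine
  \<open>mf\<close>. \<open>None\<close> means that no threshold succeeded.\<close>

definition compute_fairlets ::
  "('a node flow_network \<Rightarrow> 'a node \<times> 'a node \<Rightarrow> int) \<Rightarrow> ('a \<Rightarrow> 'a \<Rightarrow> real) \<Rightarrow>
   'a set \<Rightarrow> 'a set \<Rightarrow> nat \<Rightarrow> real \<Rightarrow> 'a set set option" where
  "compute_fairlets mf d B R t \<tau> =
     (let N = fairlet_network d B R t \<tau> in
      map_option (\<lambda>\<delta>. flow_fairlets B R (mf (N \<delta>)))
        (List.find (\<lambda>\<delta>. flow_value (N \<delta>) (mf (N \<delta>)) = int (t * card R))
          (sorted_list_of_set (distances d (B \<union> R)))))"

definition max_flow_subroutine ::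
  "('a node flow_network \<Rightarrow> 'a node \<times> 'a node \<Rightarrow> int) \<Rightarrow> ('a \<Rightarrow> 'a \<Rightarrow> real) \<Rightarrow>
   'a set \<Rightarrow> 'a set \<Rightarrow> nat \<Rightarrow> real \<Rightarrow> bool" where
  "max_flow_subroutine mf d B R t \<tau> \<longleftrightarrow>
     (\<forall>\<delta>\<in>distances d (B \<union> R).
        max_integral_flow (fairlet_network d B R t \<tau> \<delta>) (mf (fairlet_network d B R t \<tau> \<delta>)))"

lemma ex_max_integral_flow:
  assumes "finite (edges N)" and cap: "\<And>e. e \<in> edges N \<Longrightarrow> 0 \<le> cap N e"
  shows "\<exists>f. max_integral_flow N f"
proof -
  define V where "V = flow_value N ` {f. integral_flow N f}"
  have z: "integral_flow N (\<lambda>_. 0)" using cap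
    by (simp add: integral_flow_def inflow_def outflow_def)
  have b: "\<bar>flow_value N f\<bar> \<le> 2 * sum (cap N) (edges N)" if f: "integral_flow N f" for f
  proof -
    have le: "0 \<le> sum f A \<and> sum f A \<le> sum (cap N) (edges N)" if "A \<subseteq> edges N" for A
    proof -
      have "sum f A \<le> sum (cap N) A" using f that by (intro sum_mono) (auto simp: integral_flow_def)
      also have "\<dots> \<le> sum (cap N) (edges N)" using assms that by (intro sum_mono2) auto
      finally show ?thesis using f that by (auto simp: integral_flow_def intro!: sum_nonneg)
    qed
    have "0 \<le> outflow N f (source N) \<and> outflow N f (source N) \<le> sum (cap N) (edges N)"
      unfolding outflow_def by (rule le) auto
    moreover have "0 \<le> inflow N f (source N) \<and> inflow N f (source N) \<le> sum (cap N) (edges N)"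
      unfolding inflow_def by (rule le) auto
    ultimately show ?thesis unfolding flow_value_def by linarith
  qed
  have "V \<subseteq> {- (2 * sum (cap N) (edges N)) .. 2 * sum (cap N) (edges N)}"
    unfolding V_def using b by fastforce
  then have fin: "finite V" by (rule finite_subset) simp
  have "V \<noteq> {}" using z by (auto simp: V_def)
  then have "Max V \<in> V" using fin by simp
  then obtain f where "integral_flow N f" "flow_value N f = Max V" by (auto simp: V_def)
  moreover have "flow_value N g \<le> Max V" if "integral_flow N g" for g
    using that fin by (auto simp: V_def)
  ultimately show ?thesis by (auto simp: max_integral_flow_def)
qed

lemma ex_max_flow_subroutine:
  assumes "finite B" "finite R"
  shows "\<exists>mf. max_flow_subroutine mf d B R t \<tau>"
proof -
  have "\<exists>f. max_integral_flow (fairlet_network d B R t \<tau> \<delta>) f" for \<delta>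
  proof (rule ex_max_integral_flow)
    show "finite (edges (fairlet_network d B R t \<tau> \<delta>))"
      by (rule finite_subset[of _ "(Pt ` (B \<union> R) \<union> {Source, Sink}) \<times> (Pt ` (B \<union> R) \<union> {Source, Sink})"])
        (use assms in \<open>auto simp: fairlet_network_def\<close>)
  qed (auto simp: fairlet_network_def)
  then have "max_flow_subroutine (\<lambda>N. SOME f. max_integral_flow N f) d B R t \<tau>"
    by (simp add: max_flow_subroutine_def some_eq_ex)
  then show ?thesis by blast
qed

end

theory Submission
  imports Defs
begin

text \<open>An optimal fair clustering leaves no red point as an outlier: its clusters contain \<open>t\<close> times
  as many blue points as red ones, so every red outlier would force \<open>t\<close> further blue outliers,
  beyond the budget \<open>|B| - t |R|\<close>. Inside each cluster one can thus distribute the blue points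
  evenly among the red ones, and by the triangle inequality through the center this is an integral
  flow of value \<open>t |R|\<close> in the network of threshold \<open>OPT\<close>. As \<open>OPT\<close> is itself a distance, the
  algorithm stops at some \<open>\<delta> \<le> OPT\<close>, and the saturated flow found there is a fairlet
  decomposition using only pairs at distance at most \<open>2 \<delta>\<close>.\<close>

text \<open>Induction on \<open>X\<close>: a block of \<open>t\<close> elements of \<open>Y\<close>
  goes to the new point, and the rest of \<open>Y\<close> has exactly the size required for the
  remaining points.\<close>

lemma even_distribution:
  assumes "finite X" "finite Y" "card Y = t * card X"
  shows "\<exists>g. g \<in> Y \<rightarrow> X \<and> (\<forall>x\<in>X. card {y \<in> Y. g y = x} = t)"
  using assms
proof (induction X arbitrary: Y rule: finite_induct)
  case empty
  then show ?case by simp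
next
  case (insert x X)
  then have "t \<le> card Y" by simp
  then obtain S where S: "S \<subseteq> Y" "card S = t" "finite S" by (rule obtain_subset_with_card_n)
  have "card (Y - S) = t * card X" using S insert by (simp add: card_Diff_subset)
  then obtain g where g: "g \<in> Y - S \<rightarrow> X" "\<forall>x\<in>X. card {y \<in> Y - S. g y = x} = t"
    using insert.IH[of "Y - S"] insert.prems by auto
  define h where "h = (\<lambda>y. if y \<in> S then x else g y)"
  have "{y \<in> Y. h y = x} = S" using S g(1) insert.hyps(2) by (auto simp: h_def)
  moreover have "{y \<in> Y. h y = x'} = {y \<in> Y - S. g y = x'}" if "x' \<in> X" for x'
    using that insert.hyps(2) S by (auto simp: h_def)
  moreover have "h \<in> Y \<rightarrow> insert x X" using g(1) by (auto simp: h_def Pi_iff)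
  ultimately show ?case using g(2) S(2) by (intro exI[of _ h]) simp
qed


section \<open>Flows in the fairlet network\<close>

locale fairlet_graph =
  fixes d :: "'a \<Rightarrow> 'a \<Rightarrow> real" and B R :: "'a set" and t :: nat and \<tau> \<delta> :: real
  assumes finite_B: "finite B" and finite_R: "finite R" and disjoint: "B \<inter> R = {}"
begin

abbreviation "N \<equiv> fairlet_network d B R t \<tau> \<delta>"

section \<open>Conservation laws as sums over colour classes\<close>

context
  fixes f :: "'a node \<times> 'a node \<Rightarrow> int"
  assumes zero: "\<And>e. e \<notin> edges N \<Longrightarrow> f e = 0"
begin

lemma outflow_Source: "outflow N f Source = (\<Sum>b\<in>B. f (Source, Pt b))"
proof -
  have "{e \<in> edges N. fst e = Source} = (\<lambda>b. (Source, Pt b)) ` B"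
    by (auto simp: fairlet_network_def)
  then show ?thesis by (simp add: outflow_def sum.reindex inj_on_def)
qed

lemma inflow_Source: "inflow N f Source = 0"
  unfolding inflow_def by (rule sum.neutral) (auto simp: fairlet_network_def)

lemma inflow_blue:
  assumes "b \<in> B"
  shows "inflow N f (Pt b) = f (Source, Pt b)"
proof -
  have "{e \<in> edges N. snd e = Pt b} = {(Source, Pt b)}"
    using assms disjoint by (auto simp: fairlet_network_def)
  then show ?thesis by (simp add: inflow_def)
qed

text \<open>Pairs beyond the threshold are not edges, but \<open>f\<close> vanishes on them, so the
  sum may run over all of \<open>R\<close> whatever the threshold is.\<close>

lemma outflow_blue:
  assumes "b \<in> B"
  shows "outflow N f (Pt b) = (\<Sum>r\<in>R. f (Pt b, Pt r))"
proof -
  have "outflow N f (Pt b) = sum f ((\<lambda>r. (Pt b, Pt r)) ` R)"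
    unfolding outflow_def using assms disjoint finite_R
    by (intro sum.mono_neutral_left) (auto simp: fairlet_network_def intro!: zero)
  then show ?thesis by (simp add: sum.reindex inj_on_def)
qed

lemma inflow_red:
  assumes "r \<in> R"
  shows "inflow N f (Pt r) = (\<Sum>b\<in>B. f (Pt b, Pt r))"
proof -
  have "inflow N f (Pt r) = sum f ((\<lambda>b. (Pt b, Pt r)) ` B)"
    unfolding inflow_def using assms disjoint finite_B
    by (intro sum.mono_neutral_left) (auto simp: fairlet_network_def intro!: zero)
  then show ?thesis by (simp add: sum.reindex inj_on_def)
qed

lemma outflow_red:
  assumes "r \<in> R"
  shows "outflow N f (Pt r) = f (Pt r, Sink)"
proof -
  have "{e \<in> edges N. fst e = Pt r} = {(Pt r, Sink)}"
    using assms disjoint by (auto simp: fairlet_network_def)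
  then show ?thesis by (simp add: outflow_def)
qed

text \<open>Freed from edge sets, the conservation laws can be read off a given flow and also
  verified for a flow under construction.\<close>

lemma integral_flow_iff:
  "integral_flow N f \<longleftrightarrow>
     (\<forall>e\<in>edges N. 0 \<le> f e \<and> f e \<le> cap N e) \<and>
     (\<forall>b\<in>B. f (Source, Pt b) = (\<Sum>r\<in>R. f (Pt b, Pt r))) \<and>
     (\<forall>r\<in>R. (\<Sum>b\<in>B. f (Pt b, Pt r)) = f (Pt r, Sink))"
proof -
  have "verts N - {source N, sink N} = Pt ` B \<union> Pt ` R" by (auto simp: fairlet_network_def)
  then have "(\<forall>u\<in>verts N - {source N, sink N}. inflow N f u = outflow N f u) \<longleftrightarrow>
      (\<forall>b\<in>B. f (Source, Pt b) = (\<Sum>r\<in>R. f (Pt b, Pt r))) \<and>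
      (\<forall>r\<in>R. (\<Sum>b\<in>B. f (Pt b, Pt r)) = f (Pt r, Sink))"
    by (simp only: ball_Un ball_simps inflow_blue outflow_blue inflow_red outflow_red cong: ball_cong)
  moreover have "\<forall>e. e \<notin> edges N \<longrightarrow> f e = 0" using zero by blast
  ultimately show ?thesis unfolding integral_flow_def by argo
qed

end

section \<open>Integral flows and fairlets\<close>

lemma integral_flow_zero: "integral_flow N f \<Longrightarrow> e \<notin> edges N \<Longrightarrow> f e = 0"
  unfolding integral_flow_def by blast

text \<open>The last two bounds hold for arbitrary points because non-edges carry \<open>0\<close>;
  sums over a whole colour class then need no case split on edges.\<close>

lemma flow_edge_bounds:
  assumes "integral_flow N f"
  shows "r \<in> R \<Longrightarrow> f (Pt r, Sink) \<le> int t"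
    and "b \<in> B \<Longrightarrow> f (Source, Pt b) \<le> 1"
    and "0 \<le> f (Pt b, Pt r)"
    and "f (Pt b, Pt r) \<le> 1"
proof -
  have *: "\<forall>e\<in>edges N. 0 \<le> f e \<and> f e \<le> cap N e" using assms by (simp add: integral_flow_def)
  show "r \<in> R \<Longrightarrow> f (Pt r, Sink) \<le> int t" "b \<in> B \<Longrightarrow> f (Source, Pt b) \<le> 1"
    using bspec[OF *, of "(Pt r, Sink)"] bspec[OF *, of "(Source, Pt b)"]
    by (auto simp: fairlet_network_def)
  have "0 \<le> f (Pt b, Pt r) \<and> f (Pt b, Pt r) \<le> 1"
  proof (cases "(Pt b, Pt r) \<in> edges N")
    case True
    with bspec[OF *, of "(Pt b, Pt r)"] show ?thesis by (simp add: fairlet_network_def)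
  qed (simp add: integral_flow_zero[OF assms])
  then show "0 \<le> f (Pt b, Pt r)" "f (Pt b, Pt r) \<le> 1" by auto
qed

lemma flow_short:
  assumes "integral_flow N f" "f (Pt b, Pt r) \<noteq> 0"
  shows "d b r \<le> \<tau> * \<delta>"
proof -
  have "(Pt b, Pt r) \<in> edges N" using assms integral_flow_zero by blast
  then show ?thesis by (auto simp: fairlet_network_def)
qed

text \<open>Blue conservation, an exchange of summation and red conservation move the value from the
  cut at the source to the cut at the sink, whose capacity is \<open>t * card R\<close>.\<close>

lemma flow_value_sink:
  assumes f: "integral_flow N f"
  shows "flow_value N f = (\<Sum>r\<in>R. f (Pt r, Sink))"
proof -
  note z = integral_flow_zero[OF f]
  have "flow_value N f = outflow N f Source - inflow N f Source"
    by (simp add: flow_value_def fairlet_network_def)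
  also have "\<dots> = (\<Sum>b\<in>B. \<Sum>r\<in>R. f (Pt b, Pt r))"
    using f integral_flow_iff[of f] z by (simp add: outflow_Source inflow_Source)
  also have "\<dots> = (\<Sum>r\<in>R. \<Sum>b\<in>B. f (Pt b, Pt r))" by (rule sum.swap)
  also have "\<dots> = (\<Sum>r\<in>R. f (Pt r, Sink))"
    using f integral_flow_iff[of f] z by simp
  finally show ?thesis .
qed

lemma flow_value_le:
  assumes f: "integral_flow N f"
  shows "flow_value N f \<le> int (t * card R)"
proof -
  have "(\<Sum>r\<in>R. f (Pt r, Sink)) \<le> (\<Sum>r\<in>R. int t)"
    by (rule sum_mono) (rule flow_edge_bounds(1)[OF f])
  then show ?thesis by (simp add: flow_value_sink[OF f] mult.commute)
qed

lemma saturated_flow_degree: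
  assumes f: "integral_flow N f" and val: "flow_value N f = int (t * card R)" and "r \<in> R"
  shows "card {b \<in> B. f (Pt b, Pt r) = 1} = t"
proof -
  have "(\<Sum>r\<in>R. f (Pt r, Sink)) = (\<Sum>r\<in>R. int t)"
    using val by (simp add: flow_value_sink[OF f] mult.commute)
  \<comment> \<open>Each sink edge carries at most \<open>t\<close>, so equality of the sums forces
    equality in every term.\<close>
  then have "f (Pt r, Sink) = int t"
    using sum_mono_inv[of "\<lambda>r. f (Pt r, Sink)" R "\<lambda>_. int t" r]
      flow_edge_bounds(1)[OF f] \<open>r \<in> R\<close> finite_R by blast
  then have "int t = (\<Sum>b\<in>B. f (Pt b, Pt r))"
    using f integral_flow_iff[of f] integral_flow_zero[OF f] \<open>r \<in> R\<close> by simp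
  \<comment> \<open>An integer between \<open>0\<close> and \<open>1\<close> is its own indicator,
    so the inflow counts the blue points matched to \<open>r\<close>.\<close>
  also have "\<dots> = (\<Sum>b\<in>B. if f (Pt b, Pt r) = 1 then 1 else 0)"
  proof (rule sum.cong)
    fix b
    show "f (Pt b, Pt r) = (if f (Pt b, Pt r) = 1 then 1 else 0)"
      using flow_edge_bounds(3,4)[OF f, of b r] by auto
  qed simp
  also have "\<dots> = int (card {b \<in> B. f (Pt b, Pt r) = 1})"
    using finite_B by (simp add: sum.If_cases Int_def)
  finally show ?thesis by simp
qed

text \<open>Two unit edges leaving \<open>b\<close> would need two units from the source, but the
  edge into \<open>b\<close> has capacity \<open>1\<close>.\<close>

lemma flow_blue_unique:
  assumes f: "integral_flow N f" and "b \<in> B" and "r \<in> R" "r' \<in> R"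
    and "f (Pt b, Pt r) = 1" "f (Pt b, Pt r') = 1"
  shows "r = r'"
proof (rule ccontr)
  assume "r \<noteq> r'"
  then have "2 = (\<Sum>x\<in>{r, r'}. f (Pt b, Pt x))" using assms by simp
  also have "\<dots> \<le> (\<Sum>x\<in>R. f (Pt b, Pt x))"
    using assms(3,4) finite_R flow_edge_bounds(3)[OF f] by (intro sum_mono2) auto
  also have "\<dots> = f (Source, Pt b)"
    using f integral_flow_iff[of f] integral_flow_zero[OF f] \<open>b \<in> B\<close> by simp
  also have "\<dots> \<le> 1" using f \<open>b \<in> B\<close> by (rule flow_edge_bounds(2))
  finally show False by simp
qed

lemma saturated_flow_fairlets:
  assumes f: "integral_flow N f" and val: "flow_value N f = int (t * card R)"
  shows "disjoint_fairlets B R t (flow_fairlets B R f)"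
proof -
  let ?S = "\<lambda>r. {b \<in> B. f (Pt b, Pt r) = 1}"
  have "fairlet B R t ({r} \<union> ?S r)" if "r \<in> R" for r
  proof -
    have *: "({r} \<union> ?S r) \<inter> R = {r}" "({r} \<union> ?S r) \<inter> B = ?S r"
      using that disjoint by auto
    show ?thesis
      using that saturated_flow_degree[OF f val that] unfolding fairlet_def * by auto
  qed
  moreover have "disjnt ({r} \<union> ?S r) ({r'} \<union> ?S r')" if "r \<in> R" "r' \<in> R" "r \<noteq> r'" for r r'
    using that disjoint flow_blue_unique[OF f _ that(1,2)] unfolding disjnt_def by blast
  ultimately show ?thesis
    unfolding disjoint_fairlets_def flow_fairlets_def pairwise_def by blast
qed

text \<open>Converse of reading fairlets off a flow: one unit runs along \<open>Source\<close>,
  \<open>b\<close>, \<open>g b\<close>, \<open>Sink\<close> for each \<open>b\<close> in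
  \<open>S\<close>, and the fibre sizes fill every sink edge.\<close>

lemma saturating_flow:
  assumes "S \<subseteq> B" and g: "g \<in> S \<rightarrow> R" and fibres: "\<And>r. r \<in> R \<Longrightarrow> card {b \<in> S. g b = r} = t"
    and short: "\<And>b. b \<in> S \<Longrightarrow> d b (g b) \<le> \<tau> * \<delta>"
  shows "\<exists>f. integral_flow N f \<and> flow_value N f = int (t * card R)"
proof -
  \<comment> \<open>Both colours share the constructor \<open>Pt\<close>, so its case adds a
    blue-to-red part and a red-to-sink part, of which at most one is nonzero.\<close>
  define f :: "'a node \<times> 'a node \<Rightarrow> int" where
    "f = (\<lambda>(x, y). case x of
            Source \<Rightarrow> of_bool (y \<in> Pt ` S)
          | Sink \<Rightarrow> 0
          | Pt b \<Rightarrow> of_bool (b \<in> S \<and> y = Pt (g b)) + int t * of_bool (b \<in> R \<and> y = Sink))"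
  have f_simps: "f (Source, Pt b) = of_bool (b \<in> S)"
    "f (Pt b, Pt r) = of_bool (b \<in> S \<and> r = g b)"
    "r \<in> R \<Longrightarrow> f (Pt r, Sink) = int t" for b r
    by (auto simp: f_def)
  have zero: "f e = 0" if "e \<notin> edges N" for e
    using that assms by (cases e) (auto simp: f_def fairlet_network_def split: node.splits)
  have "0 \<le> f e \<and> f e \<le> cap N e" if "e \<in> edges N" for e
    using that by (auto simp: f_simps fairlet_network_def)
  moreover have "f (Source, Pt b) = (\<Sum>r\<in>R. f (Pt b, Pt r))" for b
    using g finite_R by (cases "b \<in> S") (auto simp: f_simps of_bool_def Pi_iff)
  moreover have "(\<Sum>b\<in>B. f (Pt b, Pt r)) = f (Pt r, Sink)" if "r \<in> R" for r
  proof -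
    have "B \<inter> {b \<in> S. r = g b} = {b \<in> S. g b = r}" using \<open>S \<subseteq> B\<close> by auto
    then have "(\<Sum>b\<in>B. f (Pt b, Pt r)) = int (card {b \<in> S. g b = r})"
      using finite_B by (simp add: f_simps of_bool_def sum.If_cases)
    then show ?thesis using that fibres by (simp add: f_simps)
  qed
  ultimately have "integral_flow N f" using integral_flow_iff[of f] zero by simp
  then show ?thesis by (intro exI[of _ f]) (simp add: flow_value_sink f_simps)
qed

end


section \<open>Fairlet decompositions and fair clusterings\<close>

text \<open>Every fairlet of a larger family \<open>G\<close> has a red point, which
  \<open>F\<close> already covers; as \<open>G\<close> is pairwise disjoint, it is the member of
  \<open>F\<close> through that point.\<close>

lemma fairlet_decomposition_if_covers:
  assumes F: "disjoint_fairlets B R t F" and "R \<subseteq> \<Union>F"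
  shows "fairlet_decomposition B R t F"
  unfolding fairlet_decomposition_def
proof (intro conjI allI impI F)
  fix G assume G: "disjoint_fairlets B R t G \<and> F \<subseteq> G"
  have "h \<in> F" if "h \<in> G" for h
  proof -
    have "card (h \<inter> R) = 1" using G that by (auto simp: disjoint_fairlets_def fairlet_def)
    then obtain r where r: "r \<in> h" "r \<in> R" by (auto simp: card_1_singleton_iff)
    then obtain f where "f \<in> F" "r \<in> f" using assms(2) by blast
    with r that G have "f = h"
      unfolding disjoint_fairlets_def pairwise_def disjnt_def by blast
    with \<open>f \<in> F\<close> show ?thesis by simp
  qed
  with G show "G = F" by blast
qed

text \<open>For the clustered points \<open>B'\<close> and \<open>R'\<close>, summing the balance
  over the centers gives \<open>card B' = t * card R'\<close>. The outlier budget then leaves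
  \<open>(t + 1) * (card R - card R') \<le> 0\<close>.\<close>

lemma fair_clustering_no_red_outlier:
  assumes fin: "finite B" "finite R" and "B \<inter> R = {}" and le: "t * card R \<le> card B"
    and fair: "fair_clustering B R t k (card B - t * card R) C \<alpha>" and "r \<in> R"
  shows "\<alpha> r \<noteq> None"
proof -
  let ?Q = "\<lambda>c X. {x \<in> B \<union> R. \<alpha> x = Some c} \<inter> X"
  define B' where "B' = {x \<in> B. \<alpha> x \<noteq> None}"
  define R' where "R' = {x \<in> R. \<alpha> x \<noteq> None}"
  have C: "C \<subseteq> B \<union> R" and val: "\<And>x. x \<in> B \<union> R \<Longrightarrow> \<alpha> x \<in> insert None (Some ` C)"
    and out: "card {x \<in> B \<union> R. \<alpha> x = None} \<le> card B - t * card R"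
    and bal: "\<And>c. c \<in> C \<Longrightarrow> card (?Q c B) = t * card (?Q c R)"
    using fair unfolding fair_clustering_def by blast+
  have finC: "finite C" using C fin by (auto intro: finite_subset)
  have card_UN: "card (\<Union>c\<in>C. ?Q c X) = (\<Sum>c\<in>C. card (?Q c X))" if "finite X" for X
    using finC fin that by (intro card_UN_disjoint) auto
  have "B' = (\<Union>c\<in>C. ?Q c B)" "R' = (\<Union>c\<in>C. ?Q c R)"
    using val unfolding B'_def R'_def by fastforce+
  then have BR: "card B' = t * card R'"
    using card_UN fin bal by (simp add: sum_distrib_left)
  have sub: "B' \<subseteq> B" "R' \<subseteq> R" by (auto simp: B'_def R'_def)
  have "{x \<in> B \<union> R. \<alpha> x = None} = (B - B') \<union> (R - R')" by (auto simp: B'_def R'_def)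
  then have "card {x \<in> B \<union> R. \<alpha> x = None} = card (B - B') + card (R - R')"
    using fin \<open>B \<inter> R = {}\<close> by (simp add: card_Un_disjoint disjoint_iff)
  also have "\<dots> = (card B - card B') + (card R - card R')"
    using sub fin by (simp add: card_Diff_subset finite_subset)
  finally have "(card B - card B') + (card R - card R') \<le> card B - t * card R"
    using out by simp
  \<comment> \<open>Together with \<open>le\<close>, these bounds make the truncated subtractions
    exact. The comparison of the products is supplied separately because \<open>linarith\<close>
    treats them as atoms.\<close>
  moreover have "card B' \<le> card B" "card R' \<le> card R" using sub fin by (auto intro: card_mono)
  moreover have "t * card R' \<le> t * card R" using calculation(3) by simp
  ultimately have "card R' = card R" using BR le by linarith
  then have "R' = R" using sub fin by (simp add: card_subset_eq)
  then show ?thesis using \<open>r \<in> R\<close> by (auto simp: R'_def)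
qed

text \<open>Even distributions inside the single clusters are glued along \<open>\<alpha>\<close>.
  Since no red point is an outlier, the fibre condition holds over all of \<open>R\<close>.\<close>

lemma fair_clustering_assignment:
  assumes fin: "finite B" "finite R" and "B \<inter> R = {}" and le: "t * card R \<le> card B"
    and fair: "fair_clustering B R t k (card B - t * card R) C \<alpha>"
  shows "\<exists>S g. S \<subseteq> B \<and> g \<in> S \<rightarrow> R \<and> (\<forall>r\<in>R. card {b \<in> S. g b = r} = t) \<and>
           (\<forall>b\<in>S. \<exists>c\<in>C. \<alpha> b = Some c \<and> \<alpha> (g b) = Some c)"
proof -
  let ?B = "\<lambda>c. {x \<in> B. \<alpha> x = Some c}" and ?R = "\<lambda>c. {x \<in> R. \<alpha> x = Some c}"
  have "\<exists>g. g \<in> ?B c \<rightarrow> ?R c \<and> (\<forall>r\<in>?R c. card {b \<in> ?B c. g b = r} = t)" if "c \<in> C" for c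
  proof (rule even_distribution)
    have "{x \<in> B \<union> R. \<alpha> x = Some c} \<inter> B = ?B c" "{x \<in> B \<union> R. \<alpha> x = Some c} \<inter> R = ?R c"
      by auto
    then show "card (?B c) = t * card (?R c)"
      using fair that unfolding fair_clustering_def by auto
  qed (use fin in auto)
  then have "\<exists>g. \<forall>c\<in>C. g c \<in> ?B c \<rightarrow> ?R c \<and> (\<forall>r\<in>?R c. card {b \<in> ?B c. g c b = r} = t)"
    by (intro bchoice ballI)
  then obtain g where g: "\<And>c. c \<in> C \<Longrightarrow> g c \<in> ?B c \<rightarrow> ?R c"
    and fib: "\<And>c r. c \<in> C \<Longrightarrow> r \<in> ?R c \<Longrightarrow> card {b \<in> ?B c. g c b = r} = t"
    by blast
  define S where "S = {b \<in> B. \<alpha> b \<noteq> None}"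
  \<comment> \<open>On \<open>S\<close> the label \<open>\<alpha> b\<close> is never
    \<open>None\<close>, so \<open>the\<close> selects the map of the cluster containing
    \<open>b\<close>.\<close>
  define h where "h b = g (the (\<alpha> b)) b" for b
  have val: "\<exists>c\<in>C. \<alpha> x = Some c" if "x \<in> B \<union> R" "\<alpha> x \<noteq> None" for x
  proof -
    have "\<alpha> x \<in> insert None (Some ` C)" using fair that(1) unfolding fair_clustering_def by blast
    with that(2) show ?thesis by auto
  qed
  have h: "h b \<in> R \<and> (\<exists>c\<in>C. \<alpha> b = Some c \<and> \<alpha> (h b) = Some c)" if b: "b \<in> S" for b
  proof -
    obtain c where c: "c \<in> C" "\<alpha> b = Some c" using val[of b] b unfolding S_def by blast
    then have "h b \<in> ?R c" using g[OF c(1)] b by (auto simp: h_def S_def)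
    with c show ?thesis by auto
  qed
  moreover have "card {b \<in> S. h b = r} = t" if r: "r \<in> R" for r
  proof -
    obtain c where c: "c \<in> C" "\<alpha> r = Some c"
      using val[of r] fair_clustering_no_red_outlier[OF assms r] r by blast
    \<comment> \<open>As \<open>h\<close> preserves clusters, everything mapped to \<open>r\<close>
      comes from the cluster of \<open>r\<close>, where \<open>h\<close> agrees with
      \<open>g c\<close>.\<close>
    have "b \<in> ?B c \<and> g c b = r" if "b \<in> S" "h b = r" for b
      using h[OF that(1)] that c(2) by (auto simp: S_def h_def)
    moreover have "b \<in> S \<and> h b = r" if "b \<in> ?B c" "g c b = r" for b
      using that by (simp add: S_def h_def)
    ultimately have "{b \<in> S. h b = r} = {b \<in> ?B c. g c b = r}" by blast
    then show ?thesis using fib c r by simp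
  qed
  ultimately show ?thesis by (intro exI[of _ S] exI[of _ h]) (auto simp: S_def)
qed

section \<open>Clustering costs as candidate thresholds\<close>

lemma finite_distances: "finite P \<Longrightarrow> finite (distances d P)"
proof -
  have "distances d P = (\<lambda>(x, y). d x y) ` (P \<times> P)" by (auto simp: distances_def)
  then show "finite P \<Longrightarrow> finite (distances d P)" by simp
qed

context
  fixes d :: "'a \<Rightarrow> 'a \<Rightarrow> real" and P C :: "'a set" and \<alpha> :: "'a \<Rightarrow> 'a option"
  assumes fin: "finite P" and C: "C \<subseteq> P" and val: "\<alpha> ` P \<subseteq> insert None (Some ` C)"
begin

lemma cluster_distances: "{d x c |x c. x \<in> P \<and> \<alpha> x = Some c} \<subseteq> distances d P"
proof
  fix v assume "v \<in> {d x c |x c. x \<in> P \<and> \<alpha> x = Some c}"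
  then obtain x c where x: "v = d x c" "x \<in> P" "\<alpha> x = Some c" by blast
  have "\<alpha> x \<in> insert None (Some ` C)" using val x(2) by blast
  then have "c \<in> P" using C x(3) by auto
  with x show "v \<in> distances d P" unfolding distances_def by blast
qed

lemma dist_le_clustering_cost:
  assumes "x \<in> P" "\<alpha> x = Some c"
  shows "d x c \<le> clustering_cost d P \<alpha>"
  unfolding clustering_cost_def
  using assms finite_subset[OF cluster_distances finite_distances[OF fin]] by (intro Max_ge) auto

text \<open>A cost is a maximum of point-to-center distances and the inserted \<open>0\<close>,
  hence the assumption that \<open>0\<close> is a distance. This places the optimum among the
  candidate thresholds.\<close>

lemma clustering_cost_distance:
  assumes "0 \<in> distances d P"
  shows "clustering_cost d P \<alpha> \<in> distances d P"
proof -
  let ?S = "insert 0 {d x c |x c. x \<in> P \<and> \<alpha> x = Some c}"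
  have "Max ?S \<in> ?S"
    using finite_subset[OF cluster_distances finite_distances[OF fin]] by (intro Max_in) auto
  moreover have "?S \<subseteq> distances d P"
    using cluster_distances assms by (rule insert_subsetI[rotated])
  ultimately show ?thesis
    unfolding clustering_cost_def by blast
qed

end

text \<open>The first hit in an increasing list is the least one, so any known success
  \<open>x\<close> bounds it.\<close>

lemma find_sorted_list_of_set:
  assumes "finite D" "x \<in> D" "Q x"
  shows "\<exists>y\<in>D. List.find Q (sorted_list_of_set D) = Some y \<and> Q y \<and> y \<le> x"
proof -
  let ?xs = "sorted_list_of_set D"
  obtain y where y: "List.find Q ?xs = Some y"
    using assms by (cases "List.find Q ?xs") (auto simp: find_None_iff)
  then obtain i where i: "i < length ?xs" "Q (?xs ! i)" "y = ?xs ! i" "\<And>j. j < i \<Longrightarrow> \<not> Q (?xs ! j)"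
    by (auto simp: find_Some_iff)
  obtain j where j: "j < length ?xs" "?xs ! j = x"
    using assms(1,2) by (metis in_set_conv_nth set_sorted_list_of_set)
  \<comment> \<open>A position of \<open>x\<close> before \<open>i\<close> would contradict that the
    search first succeeds at \<open>i\<close>.\<close>
  have "i \<le> j" using i(4) j assms(3) by (meson not_le_imp_less)
  then have "y \<le> x" using i j by (metis sorted_nth_mono sorted_sorted_list_of_set)
  moreover have "y \<in> D" using i assms(1) by (metis nth_mem set_sorted_list_of_set)
  ultimately show ?thesis using y i by blast
qed

section \<open>Correctness of the threshold search\<close>

theorem corollaryB3:
  fixes d :: "'a \<Rightarrow> 'a \<Rightarrow> real" and P B R :: "'a set" and t k :: nat
    and mf :: "'a node flow_network \<Rightarrow> 'a node \<times> 'a node \<Rightarrow> int"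
  assumes "1 \<le> t" and "1 \<le> k"
    and "Metric_space P d" and "finite P" and "P \<noteq> {}"
    and "P = B \<union> R" and "B \<inter> R = {}"
    and "t * card R \<le> card B"
    and "max_flow_subroutine mf d B R t 2"
  shows "\<exists>F. compute_fairlets mf d B R t 2 = Some F \<and>
             fairlet_decomposition B R t F \<and>
             (\<forall>f\<in>F. \<forall>b\<in>f \<inter> B. d (anchor R f) b \<le> 2 * OPT_fair d B R t k)"
proof -
  interpret Metric_space P d by fact
  let ?OPT = "OPT_fair d B R t k" and ?D = "distances d P" and ?N = "fairlet_network d B R t 2"
  have fin: "finite B" "finite R" using \<open>finite P\<close> \<open>P = B \<union> R\<close> by auto
  \<comment> \<open>\<open>\<delta>\<close> stays free so that the network lemmas apply both at the
    optimum and at the returned threshold.\<close>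
  interpret G: fairlet_graph d B R t 2 \<delta> for \<delta>
    using fin \<open>B \<inter> R = {}\<close> by unfold_locales
  obtain C \<alpha> where fair: "fair_clustering B R t k (card B - t * card R) C \<alpha>"
    and cost: "clustering_cost d P \<alpha> = ?OPT"
    using OPT_fair_attained[OF fin, of t k d] assms by auto
  have C: "C \<subseteq> P" and val: "\<alpha> ` P \<subseteq> insert None (Some ` C)"
    using fair \<open>P = B \<union> R\<close> unfolding fair_clustering_def by auto
  note center = dist_le_clustering_cost[where d = d, OF \<open>finite P\<close> C val, unfolded cost]
  obtain p where "p \<in> P" using \<open>P \<noteq> {}\<close> by blast
  \<comment> \<open>The distance from \<open>p\<close> to itself supplies \<open>0\<close>.\<close>
  then have "0 \<in> ?D" unfolding distances_def by (auto intro!: exI[of _ p])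
  then have OPT_in: "?OPT \<in> ?D"
    using clustering_cost_distance[where d = d, OF \<open>finite P\<close> C val] cost by simp

  obtain S g where S: "S \<subseteq> B" and g: "g \<in> S \<rightarrow> R" "\<forall>r\<in>R. card {b \<in> S. g b = r} = t"
    and same: "\<forall>b\<in>S. \<exists>c\<in>C. \<alpha> b = Some c \<and> \<alpha> (g b) = Some c"
    using fair_clustering_assignment[OF fin \<open>B \<inter> R = {}\<close> \<open>t * card R \<le> card B\<close> fair] by blast
  have short: "d b (g b) \<le> 2 * ?OPT" if b: "b \<in> S" for b
  proof -
    obtain c where c: "c \<in> C" "\<alpha> b = Some c" "\<alpha> (g b) = Some c" using same b by blast
    have mem: "b \<in> P" "g b \<in> P" "c \<in> P" using S g(1) b c(1) C \<open>P = B \<union> R\<close> by auto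
    \<comment> \<open>Both points lie within the optimum of their common center, which is the origin
      of the factor \<open>2\<close>.\<close>
    have "d b (g b) \<le> d b c + d (g b) c"
      using triangle[OF mem(1,3,2)] by (simp add: commute)
    then show ?thesis using center[OF mem(1) c(2)] center[OF mem(2) c(3)] by simp
  qed
  obtain f0 where f0: "integral_flow (?N ?OPT) f0" "flow_value (?N ?OPT) f0 = int (t * card R)"
    using G.saturating_flow[OF S g(1), of ?OPT] g(2) short by auto
  have mf: "max_integral_flow (?N \<delta>) (mf (?N \<delta>))" if "\<delta> \<in> ?D" for \<delta>
    using that assms unfolding max_flow_subroutine_def by simp
  \<comment> \<open>The maximum is at least the value of \<open>f0\<close> and, by the capacity of
    the sink cut, at most \<open>t * card R\<close>.\<close>
  have "flow_value (?N ?OPT) (mf (?N ?OPT)) = int (t * card R)"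
    using mf[OF OPT_in] f0 G.flow_value_le unfolding max_integral_flow_def by (metis order_antisym)
  then obtain \<delta> where \<delta>: "\<delta> \<in> ?D" "\<delta> \<le> ?OPT"
    and find: "List.find (\<lambda>\<delta>. flow_value (?N \<delta>) (mf (?N \<delta>)) = int (t * card R))
                 (sorted_list_of_set ?D) = Some \<delta>"
    and saturated: "flow_value (?N \<delta>) (mf (?N \<delta>)) = int (t * card R)"
    using find_sorted_list_of_set[OF finite_distances[OF \<open>finite P\<close>] OPT_in,
        of "\<lambda>\<delta>. flow_value (?N \<delta>) (mf (?N \<delta>)) = int (t * card R)"]
    by blast
  define f where "f = mf (?N \<delta>)"
  have f: "integral_flow (?N \<delta>) f" "flow_value (?N \<delta>) f = int (t * card R)"
    using mf[OF \<delta>(1)] saturated by (auto simp: f_def max_integral_flow_def)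
  show ?thesis
  proof (intro exI[of _ "flow_fairlets B R f"] conjI ballI)
    show "compute_fairlets mf d B R t 2 = Some (flow_fairlets B R f)"
      using find \<open>P = B \<union> R\<close> by (simp add: compute_fairlets_def f_def)
    \<comment> \<open>Each of these fairlets contains its own red point, so \<open>R\<close> is
      covered and maximality follows.\<close>
    show "fairlet_decomposition B R t (flow_fairlets B R f)"
      by (rule fairlet_decomposition_if_covers[OF G.saturated_flow_fairlets[OF f]])
        (auto simp: flow_fairlets_def)
  next
    fix h b assume h: "h \<in> flow_fairlets B R f" and b: "b \<in> h \<inter> B"
    then obtain r where r: "r \<in> R" "h = {r} \<union> {b \<in> B. f (Pt b, Pt r) = 1}"
      by (auto simp: flow_fairlets_def)
    have "h \<inter> R = {r}" using r \<open>B \<inter> R = {}\<close> by auto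
    then have "anchor R h = r" unfolding anchor_def by simp
    \<comment> \<open>\<open>b\<close> is blue and \<open>r\<close> is red, so \<open>b\<close>
      belongs to the part of \<open>h\<close> given by the flow.\<close>
    moreover have "f (Pt b, Pt r) = 1" using b r \<open>B \<inter> R = {}\<close> by auto
    then have "d b r \<le> 2 * \<delta>" using G.flow_short[OF f(1)] by simp
    ultimately show "d (anchor R h) b \<le> 2 * ?OPT" using \<delta>(2) commute[of b r] by simp
  qed
qed

end
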